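(* For every integer $s$, \[ \sum_{n=1}^\infty \frac{F_{2n+s}}{n^2(n+1)C_n}=\frac{\pi^2}{50\sqrt5}(9\alpha^s-\beta^s),\qquad \sum_{n=1}^\infty \frac{L_{2n+s}}{n^2(n+1)C_n}=\frac{\pi^2}{50}(9\alpha^s+\beta^s). \]
   Context: $C_n=\frac{1}{n+1}\binom{2n}{n}$ are the Catalan numbers. $\alpha=\frac{1+\sqrt5}{2}$, $\beta=\frac{1-\sqrt5}{2}$. The Fibonacci and Lucas numbers are defined for all integers $n$ by $F_n=\frac{\alpha^n-\beta^n}{\alpha-\beta}$ and $L_n=\alpha^n+\beta^n$. *)

theory Defs
  imports "HOL-Analysis.Analysis" "HOL-Number_Theory.Fib"
begin

definition alpha :: real where
  "alpha = (1 + sqrt 5) / 2"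

definition beta :: real where
  "beta = (1 - sqrt 5) / 2"

(* Indexed by all integers, unlike the library's fib on nat; real-valued, as given by the
   Binet formula. *)
definition Fibonacci :: "int \<Rightarrow> real" where
  "Fibonacci n = (alpha powi n - beta powi n) / (alpha - beta)"

definition Lucas :: "int \<Rightarrow> real" where
  "Lucas n = alpha powi n + beta powi n"

definition catalan :: "nat \<Rightarrow> real" where
  "catalan n = 1 / (real n + 1) * real ((2 * n) choose n)"

lemma Fibonacci_of_nat: "Fibonacci (int n) = real (fib n)"
proof -
  have "alpha - beta = sqrt 5"
    by (simp add: alpha_def beta_def field_simps)
  then show ?thesis
    using fib_closed_form[of n]
    by (simp add: Fibonacci_def alpha_def beta_def)
qed

end

theory Submission
  imports Defs
begin

text \<open>
  Since \<open>n\<^sup>2 (n + 1) C\<^sub>n = n\<^sup>2 (2n choose n)\<close>, both series are combinations of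
  \<open>\<Sum> (2x)\<^sup>2\<^sup>n / (n\<^sup>2 (2n choose n)) = 2 (arcsin x)\<^sup>2\<close> at \<open>2x = \<alpha>\<close> and \<open>2x = -\<beta>\<close>, that is, at
  \<open>x = sin (3\<pi>/10)\<close> and \<open>x = sin (\<pi>/10)\<close>. The arcsine series holds because \<open>f = (arcsin x)\<^sup>2\<close> and half
  the series both solve \<open>(1 - x\<^sup>2) f'' - x f' = 2\<close> with \<open>f 0 = f' 0 = 0\<close>; this equation is the
  two-step recursion for the coefficients.
\<close>

section \<open>Taylor coefficients of the squared arcsine\<close>

text \<open>The zeros at indices 0 and 1 are the initial values. The differential equation, read at
  x^m, gives (m + 1)(m + 2) c(m+2) - m^2 c(m) on the left; its right-hand side 2 contributes only at
  m = 0.\<close>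

fun arcsin_sq_coeff :: "nat \<Rightarrow> real" where
  "arcsin_sq_coeff 0 = 0"
| "arcsin_sq_coeff (Suc 0) = 0"
| "arcsin_sq_coeff (Suc (Suc m)) =
     ((real m)\<^sup>2 * arcsin_sq_coeff m + (if m = 0 then 2 else 0)) / (real (m + 1) * real (m + 2))"

text \<open>Crude, but enough to compare the power series with a geometric series on
  \<open>|x| < 1\<close>.\<close>

lemma arcsin_sq_coeff_bounds: "0 \<le> arcsin_sq_coeff m \<and> arcsin_sq_coeff m \<le> 1"
proof (induction m rule: arcsin_sq_coeff.induct)
  case (3 m)
  have "(real m)\<^sup>2 * arcsin_sq_coeff m \<le> (real m)\<^sup>2"
    using 3 by (simp add: mult_left_le)
  then have "(real m)\<^sup>2 * arcsin_sq_coeff m + (if m = 0 then 2 else 0) \<le> real (m + 1) * real (m + 2)"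
    by (auto simp: power2_eq_square algebra_simps)
  then show ?case
    using 3 by (auto simp: divide_simps)
qed auto

text \<open>The recursion preserves parity; the odd indices start from 0 and never meet the constant
  2.\<close>

lemma arcsin_sq_coeff_odd: "odd m \<Longrightarrow> arcsin_sq_coeff m = 0"
  by (induction m rule: arcsin_sq_coeff.induct) (auto simp: odd_pos)

lemma central_binomial_Suc:
  "(real n + 1) * real ((2 * Suc n) choose Suc n) = 2 * (2 * real n + 1) * real ((2 * n) choose n)"
proof -
  have "real ((2 * Suc n) choose Suc n) = fact (2 * n + 2) / (fact (Suc n) * fact (Suc n))"
    by (subst binomial_fact) auto
  also have "\<dots> = (2 * real n + 2) * (2 * real n + 1) * fact (2 * n) /
      ((real n + 1) * fact n * ((real n + 1) * fact n))"
    by (simp add: algebra_simps)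
  finally have 1: "real ((2 * Suc n) choose Suc n) = \<dots>" .
  have 2: "real ((2 * n) choose n) = fact (2 * n) / (fact n * fact n)"
    by (subst binomial_fact) auto
  show ?thesis
    unfolding 1 2 by (simp add: divide_simps) (simp add: algebra_simps)
qed

text \<open>The recursion multiplies by (2n + 2)^2 / ((2n + 3)(2n + 4)), which the ratio of
  consecutive central binomials matches. The induction starts at index 2 because the constant 2
  enters only in producing that coefficient.\<close>

lemma arcsin_sq_coeff_even:
  "arcsin_sq_coeff (2 * Suc n) = 4 ^ Suc n / (2 * (real (Suc n))\<^sup>2 * real ((2 * Suc n) choose Suc n))"
proof (induction n)
  case 0
  show ?case by (simp add: numeral_2_eq_2)
next
  case (Suc n)
  define B where "B = real ((2 * Suc n) choose Suc n)"
  define B' where "B' = real ((2 * Suc (Suc n)) choose Suc (Suc n))"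
  have B: "B > 0" unfolding B_def by (subst of_nat_0_less_iff) (rule zero_less_binomial, simp)
  have "(real n + 2) * B' = 2 * (2 * real n + 3) * B"
    using central_binomial_Suc[of "Suc n"] by (simp add: B_def B'_def add.commute)
  then have B': "B' = 2 * (2 * real n + 3) * B / (real n + 2)"
    by (simp add: field_simps)
  have IH: "arcsin_sq_coeff (2 * Suc n) = 4 ^ Suc n / (2 * (real n + 1)\<^sup>2 * B)"
    using Suc unfolding B_def by (simp add: add.commute)
  have "arcsin_sq_coeff (2 * Suc (Suc n)) = arcsin_sq_coeff (Suc (Suc (2 * Suc n)))"
    by simp
  also have "\<dots> = (2 * (real n + 1))\<^sup>2 * arcsin_sq_coeff (2 * Suc n) /
      ((2 * real n + 3) * (2 * real n + 4))"
    unfolding arcsin_sq_coeff.simps(3) by (simp add: algebra_simps del: arcsin_sq_coeff.simps)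
  also have "\<dots> = 2 * 4 ^ Suc n / (B * ((2 * real n + 3) * (2 * real n + 4)))"
    unfolding IH power_mult_distrib by simp
  also have "\<dots> = 4 ^ Suc (Suc n) / (2 * (real n + 2)\<^sup>2 * B')"
    using B unfolding B' by (simp add: divide_simps power2_eq_square) (simp add: algebra_simps)
  finally show ?case
    by (simp add: B'_def add.commute)
qed

section \<open>Summation of the arcsine series\<close>

text \<open>The sum \<open>g\<close> and its termwise derivatives \<open>g1\<close>,
  \<open>g2\<close> satisfy the differential equation, which is then integrated twice: each time a
  function with zero derivative on (-1, 1) is compared with its value at 0.\<close>

lemma arcsin_sq_coeff_sums:
  assumes x: "\<bar>x\<bar> < 1"
  shows "(\<lambda>m. arcsin_sq_coeff m * x ^ m) sums (arcsin x)\<^sup>2"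
proof -
  let ?c = arcsin_sq_coeff
  define g where "g \<equiv> \<lambda>x. \<Sum>n. ?c n * x ^ n"
  define g1 where "g1 \<equiv> \<lambda>x. \<Sum>n. diffs ?c n * x ^ n"
  define g2 where "g2 \<equiv> \<lambda>x. \<Sum>n. diffs (diffs ?c) n * x ^ n"
  have summ: "summable (\<lambda>n. ?c n * x ^ n)" if "\<bar>x\<bar> < 1" for x
  proof (rule summable_comparison_test')
    show "summable (\<lambda>n. \<bar>x\<bar> ^ n)"
      using that by (simp add: summable_geometric)
    show "norm (?c n * x ^ n) \<le> \<bar>x\<bar> ^ n" if "n \<ge> 0" for n
      using arcsin_sq_coeff_bounds[of n] by (simp add: abs_mult power_abs mult_left_le_one_le)
  qed
  have summ1: "summable (\<lambda>n. diffs ?c n * x ^ n)" if "\<bar>x\<bar> < 1" for x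
    by (rule termdiff_converges[of x 1]) (use that summ in auto)
  have summ2: "summable (\<lambda>n. diffs (diffs ?c) n * x ^ n)" if "\<bar>x\<bar> < 1" for x
    by (rule termdiff_converges[of x 1]) (use that summ1 in auto)
  have dg: "(g has_real_derivative g1 x) (at x)" if "\<bar>x\<bar> < 1" for x
    unfolding g_def g1_def
    by (rule termdiffs_strong'[of 1])
       (use that summ in auto)
  have dg1: "(g1 has_real_derivative g2 x) (at x)" if "\<bar>x\<bar> < 1" for x
    unfolding g1_def g2_def
    by (rule termdiffs_strong'[of 1]) (use that summ1 in auto)
  have ode: "(1 - x\<^sup>2) * g2 x - x * g1 x = 2" if x: "\<bar>x\<bar> < 1" for x
  proof -
    have s1: "(\<lambda>n. diffs ?c n * x ^ n) sums g1 x"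
      unfolding g1_def using summ1[OF x] by (rule summable_sums)
    have s2: "(\<lambda>n. diffs (diffs ?c) n * x ^ n) sums g2 x"
      unfolding g2_def using summ2[OF x] by (rule summable_sums)
    have "(\<lambda>n. real (Suc n) * ?c (Suc n) * x ^ Suc n) sums (x * g1 x)"
      using sums_mult[OF s1, of x] by (simp add: diffs_def mult_ac)
    then have t1: "(\<lambda>n. real n * ?c n * x ^ n) sums (x * g1 x)"
      by (subst (asm) sums_Suc_iff) simp
    have "(\<lambda>n. real (Suc (Suc n)) * real (Suc n) * ?c (Suc (Suc n)) * x ^ Suc (Suc n))
        sums (x\<^sup>2 * g2 x)"
      using sums_mult[OF s2, of "x\<^sup>2"]
      by (simp add: diffs_def mult_ac power2_eq_square del: arcsin_sq_coeff.simps of_nat_Suc)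
    then have "(\<lambda>n. real (Suc n) * real n * ?c (Suc n) * x ^ Suc n) sums (x\<^sup>2 * g2 x)"
      by (subst (asm) sums_Suc_iff[where f = "\<lambda>n. real (Suc n) * real n * ?c (Suc n) * x ^ Suc n"]) simp
    \<comment> \<open>Each index shift adds a term that is 0. The truncated \<open>n - 1\<close> is
      harmless at n = 0 because of the factor \<open>real n\<close>.\<close>
    then have t2: "(\<lambda>n. real n * real (n - 1) * ?c n * x ^ n) sums (x\<^sup>2 * g2 x)"
      using sums_Suc_iff[of "\<lambda>n. real n * real (n - 1) * ?c n * x ^ n" "x\<^sup>2 * g2 x"] by simp
    have "(\<lambda>n. diffs (diffs ?c) n * x ^ n - real n * real (n - 1) * ?c n * x ^ n
        - real n * ?c n * x ^ n) sums (g2 x - x\<^sup>2 * g2 x - x * g1 x)"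
      by (intro sums_diff s2 t1 t2)
    also have "(\<lambda>n. diffs (diffs ?c) n * x ^ n - real n * real (n - 1) * ?c n * x ^ n
        - real n * ?c n * x ^ n) = (\<lambda>n. if n = 0 then 2 else 0)"
    proof
      fix n
      \<comment> \<open>This is the recursion with its denominator cleared. Subtracting n(n - 1) + n
        = n^2 times \<open>?c n\<close> leaves only the constant at n = 0.\<close>
      have "diffs (diffs ?c) n = (real n)\<^sup>2 * ?c n + (if n = 0 then 2 else 0)"
        by (simp add: diffs_def divide_simps)
      moreover have "real n * real (n - 1) = (real n)\<^sup>2 - real n"
        by (cases n) (auto simp: power2_eq_square algebra_simps)
      ultimately show "diffs (diffs ?c) n * x ^ n - real n * real (n - 1) * ?c n * x ^ n
        - real n * ?c n * x ^ n = (if n = 0 then 2 else 0)"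
        by (auto simp: algebra_simps)
    qed
    finally have "(\<lambda>n. if n = 0 then 2 else 0) sums (g2 x - x\<^sup>2 * g2 x - x * g1 x)" .
    moreover have "(\<lambda>n::nat. if n = 0 then 2 else 0 :: real) sums 2"
      using sums_single[of 0 "\<lambda>_. 2::real"] by simp
    ultimately have "g2 x - x\<^sup>2 * g2 x - x * g1 x = 2"
      by (rule sums_unique2)
    then show ?thesis by (simp add: algebra_simps)
  qed
  have g0: "g 0 = 0" and g10: "g1 0 = 0"
    unfolding g_def g1_def by (simp_all add: powser_zero diffs_def)
  have pos: "1 - x\<^sup>2 > 0" if "\<bar>x\<bar> < 1" for x :: real
    using that by (simp add: abs_square_less_1)
  have first_integral: "sqrt (1 - x\<^sup>2) * g1 x = 2 * arcsin x" if x: "\<bar>x\<bar> < 1" for x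
  proof -
    \<comment> \<open>Dividing the equation by sqrt (1 - x^2) turns its left side into the
      derivative of sqrt (1 - x^2) * \<open>g1 x\<close> and its right side into that of 2 arcsin
      x.\<close>
    let ?D = "\<lambda>x. sqrt (1 - x\<^sup>2) * g1 x - 2 * arcsin x"
    have "(?D has_real_derivative 0) (at y)" if "-1 < y" "y < 1" for y
    proof -
      have y: "\<bar>y\<bar> < 1" using that by auto
      have p: "1 - y\<^sup>2 > 0" by (rule pos[OF y])
      have sq: "sqrt (1 - y\<^sup>2) * sqrt (1 - y\<^sup>2) = 1 - y\<^sup>2" "sqrt (1 - y\<^sup>2) > 0"
        using p by auto
      have "(?D has_real_derivative
          (sqrt (1 - y\<^sup>2) * g2 y + (- (2 * y) * (inverse (sqrt (1 - y\<^sup>2)) / 2)) * g1 y)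
           - 2 * inverse (sqrt (1 - y\<^sup>2))) (at y)"
        by (rule derivative_eq_intros DERIV_arcsin dg1[OF y] DERIV_real_sqrt[THEN DERIV_chain2]
             refl p that | simp add: p)+
      also have "(sqrt (1 - y\<^sup>2) * g2 y + (- (2 * y) * (inverse (sqrt (1 - y\<^sup>2)) / 2)) * g1 y)
           - 2 * inverse (sqrt (1 - y\<^sup>2))
         = ((sqrt (1 - y\<^sup>2) * sqrt (1 - y\<^sup>2)) * g2 y - y * g1 y - 2) / sqrt (1 - y\<^sup>2)"
        using sq(2) by (simp add: field_simps del: real_sqrt_mult_self)
      also have "\<dots> = 0"
        unfolding sq(1) using ode[OF y] by simp
      finally show ?thesis .
    qed
    then have "?D x = ?D 0"
      using x by (intro DERIV_isconst3[of "-1" 1 x 0 ?D]) auto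
    then show ?thesis by (simp add: g10)
  qed
  \<comment> \<open>The first integral, solved for \<open>g1\<close>, is exactly the derivative of
    the squared arcsine.\<close>
  have "((\<lambda>x. g x - (arcsin x)\<^sup>2) has_real_derivative 0) (at y)" if "-1 < y" "y < 1" for y
  proof -
    have y: "\<bar>y\<bar> < 1" using that by auto
    have p: "sqrt (1 - y\<^sup>2) > 0" using pos[OF y] by simp
    have "((\<lambda>x. g x - (arcsin x)\<^sup>2) has_real_derivative
        g1 y - 2 * arcsin y * inverse (sqrt (1 - y\<^sup>2))) (at y)"
      by (rule derivative_eq_intros DERIV_arcsin dg[OF y] refl that | simp)+
    also have "g1 y - 2 * arcsin y * inverse (sqrt (1 - y\<^sup>2)) = 0"
      using first_integral[OF y] p by (simp add: field_simps)
    finally show ?thesis .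
  qed
  then have "g x - (arcsin x)\<^sup>2 = g 0 - (arcsin 0)\<^sup>2"
    using x by (intro DERIV_isconst3[of "-1" 1 x 0 "\<lambda>x. g x - (arcsin x)\<^sup>2"]) auto
  then have "g x = (arcsin x)\<^sup>2" by (simp add: g0)
  then show ?thesis
    using summable_sums[OF summ[OF x]] by (simp add: g_def)
qed

text \<open>Only even powers survive in the arcsine series, and the one of index 0 has coefficient
  0. The 4^n of the closed form merges with x^(2n), and doubling clears its factor 1/2.\<close>

lemma sums_inverse_central_binomial:
  assumes "\<bar>x\<bar> < 1"
  shows "(\<lambda>k. (2 * x) ^ (2 * Suc k) / ((real (Suc k))\<^sup>2 * real ((2 * Suc k) choose Suc k)))
           sums (2 * (arcsin x)\<^sup>2)"
proof -
  let ?f = "\<lambda>m. arcsin_sq_coeff m * x ^ m"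
  have "(\<lambda>n. ?f (2 * n)) sums (arcsin x)\<^sup>2"
  proof (subst sums_mono_reindex)
    show "strict_mono (\<lambda>n::nat. 2 * n)" by (simp add: strict_mono_def)
    show "?f n = 0" if "n \<notin> range (\<lambda>n. 2 * n)" for n
      using that arcsin_sq_coeff_odd[of n] by (metis dvdE mult_zero_left rangeI)
  qed (rule arcsin_sq_coeff_sums[OF assms])
  then have "(\<lambda>k. ?f (2 * Suc k)) sums (arcsin x)\<^sup>2"
    by (subst sums_Suc_iff[where f = "\<lambda>n. ?f (2 * n)"]) simp
  then have "(\<lambda>k. 2 * ?f (2 * Suc k)) sums (2 * (arcsin x)\<^sup>2)"
    by (rule sums_mult)
  moreover have "2 * ?f (2 * Suc k) =
      (2 * x) ^ (2 * Suc k) / ((real (Suc k))\<^sup>2 * real ((2 * Suc k) choose Suc k))" for k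
  proof -
    have *: "(2 * x) ^ (2 * Suc k) = 4 ^ Suc k * x ^ (2 * Suc k)"
      by (simp add: power_mult_distrib power_mult[of 2] del: power_Suc mult_Suc_right)
    show ?thesis
      unfolding * arcsin_sq_coeff_even by (simp del: power_Suc mult_Suc_right binomial_Suc_Suc)
  qed
  ultimately show ?thesis by (simp only:)
qed

section \<open>The two special angles\<close>

text \<open>For t = pi/10 the angles 2t and 3t are complementary, so sin 2t = cos 3t. Dividing by
  cos t leaves a quadratic equation for sin t, whose positive root is meant.\<close>

lemma sin_pi_tenth: "sin (pi / 10) = - beta / 2"
proof -
  define s c where "s = sin (pi / 10)" and "c = cos (pi / 10)"
  have c: "c > 0" and s: "s > 0"
    unfolding c_def s_def using pi_gt_zero by (auto intro!: cos_gt_zero sin_gt_zero2)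
  have "sin (2 * (pi / 10)) = cos (3 * (pi / 10))"
    by (simp add: sin_cos_eq field_simps)
  then have "2 * s * c = 4 * c ^ 3 - 3 * c"
    by (simp only: sin_double cos_treble_cos s_def c_def)
  then have "c * (2 * s) = c * (4 * c\<^sup>2 - 3)"
    by (simp add: power3_eq_cube power2_eq_square algebra_simps)
  then have "2 * s = 4 * c\<^sup>2 - 3" using c by simp
  moreover have "c\<^sup>2 = 1 - s\<^sup>2" unfolding c_def s_def by (rule cos_squared_eq)
  ultimately have "(4 * s + 1)\<^sup>2 = 5"
    by (simp add: power2_eq_square algebra_simps)
  then have "4 * s + 1 = sqrt 5"
    using s by (intro real_sqrt_unique[symmetric]) auto
  then show ?thesis by (simp add: s_def beta_def field_simps)
qed

text \<open>The angle is complementary to 2 (pi/10), so the double-angle formula reduces it to the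
  previous value.\<close>

lemma sin_three_pi_tenths: "sin (3 * pi / 10) = alpha / 2"
proof -
  have "sin (3 * pi / 10) = cos (2 * (pi / 10))"
    by (simp add: sin_cos_eq field_simps)
  also have "\<dots> = 1 - 2 * (beta / 2)\<^sup>2"
    by (simp only: cos_double_sin sin_pi_tenth) (simp add: power2_eq_square)
  also have "\<dots> = alpha / 2"
    by (simp add: alpha_def beta_def power2_eq_square field_simps)
  finally show ?thesis .
qed

lemma sums_inverse_central_binomial_sin:
  assumes "0 \<le> t" "t < pi / 2"
  shows "(\<lambda>k. (2 * sin t) ^ (2 * Suc k) / ((real (Suc k))\<^sup>2 * real ((2 * Suc k) choose Suc k)))
           sums (2 * t\<^sup>2)"
proof -
  have "0 \<le> sin t" using assms by (intro sin_ge_zero) auto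
  moreover have "sin t < sin (pi / 2)"
    using assms by (subst sin_mono_less_eq) auto
  ultimately have "\<bar>sin t\<bar> < 1" by simp
  moreover have "arcsin (sin t) = t" using assms by (intro arcsin_sin) auto
  ultimately show ?thesis using sums_inverse_central_binomial[of "sin t"] by simp
qed

text \<open>Here t = 3 pi/10 and 2 t^2 = 9 pi^2/50, the source of the 9 in the theorem.\<close>

lemma alpha_sums:
  "(\<lambda>k. alpha ^ (2 * Suc k) / ((real (Suc k))\<^sup>2 * real ((2 * Suc k) choose Suc k)))
     sums (9 * pi\<^sup>2 / 50)"
  using sums_inverse_central_binomial_sin[of "3 * pi / 10"] unfolding sin_three_pi_tenths
  by (simp add: power_divide power_mult_distrib del: power_Suc mult_Suc_right)

text \<open>At t = pi/10, 2 sin t is -\<beta>; the even exponent removes the sign.\<close>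

lemma beta_sums:
  "(\<lambda>k. beta ^ (2 * Suc k) / ((real (Suc k))\<^sup>2 * real ((2 * Suc k) choose Suc k)))
     sums (pi\<^sup>2 / 50)"
  using sums_inverse_central_binomial_sin[of "pi / 10"] unfolding sin_pi_tenth
  by (simp add: power_divide del: power_Suc mult_Suc_right)

theorem theorem5:
  fixes s :: int
  shows "((\<lambda>k. let n = Suc k in
            Fibonacci (2 * int n + s) / ((real n)\<^sup>2 * (real n + 1) * catalan n))
           sums (pi\<^sup>2 / (50 * sqrt 5) * (9 * alpha powi s - beta powi s)))
       \<and> ((\<lambda>k. let n = Suc k in
            Lucas (2 * int n + s) / ((real n)\<^sup>2 * (real n + 1) * catalan n))
           sums (pi\<^sup>2 / 50 * (9 * alpha powi s + beta powi s)))"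
proof
  have "alpha > 0" by (simp add: alpha_def add_pos_pos)
  moreover have "beta < 0" by (simp add: beta_def)
  ultimately have nz: "alpha \<noteq> 0" "beta \<noteq> 0" by auto
  \<comment> \<open>Since \<open>s\<close> may be negative, splitting the exponent relies on a
    nonzero base.\<close>
  have powi: "a powi (2 * int n + s) = a powi s * a ^ (2 * n)" if "a \<noteq> 0" for a :: real and n
  proof -
    have "a powi (2 * int n) = a ^ (2 * n)"
      using power_int_of_nat[of a "2 * n"] by simp
    then show ?thesis using that by (simp add: power_int_add)
  qed
  \<comment> \<open>The factor n + 1 cancels the denominator of the Catalan number.\<close>
  have catalan: "(real n)\<^sup>2 * (real n + 1) * catalan n = (real n)\<^sup>2 * real ((2 * n) choose n)" for n
    by (simp add: catalan_def add_nonneg_eq_0_iff)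
  have diff: "alpha - beta = sqrt 5"
    by (simp add: alpha_def beta_def field_simps)
  let ?d = "\<lambda>k. (real (Suc k))\<^sup>2 * real ((2 * Suc k) choose Suc k)"
  note A = sums_mult[OF alpha_sums, of "alpha powi s"]
  note B = sums_mult[OF beta_sums, of "beta powi s"]
  \<comment> \<open>Binet's formula, with \<alpha> - \<beta> = sqrt 5, splits the series into the
    two known sums.\<close>
  have "(\<lambda>k. (alpha powi s * (alpha ^ (2 * Suc k) / ?d k) - beta powi s * (beta ^ (2 * Suc k) / ?d k)) / sqrt 5)
      sums ((alpha powi s * (9 * pi\<^sup>2 / 50) - beta powi s * (pi\<^sup>2 / 50)) / sqrt 5)"
    by (intro sums_divide sums_diff A B)
  moreover have "(alpha powi s * (9 * pi\<^sup>2 / 50) - beta powi s * (pi\<^sup>2 / 50)) / sqrt 5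
      = pi\<^sup>2 / (50 * sqrt 5) * (9 * alpha powi s - beta powi s)"
    by (simp add: field_simps)
  ultimately show "(\<lambda>k. let n = Suc k in
            Fibonacci (2 * int n + s) / ((real n)\<^sup>2 * (real n + 1) * catalan n))
           sums (pi\<^sup>2 / (50 * sqrt 5) * (9 * alpha powi s - beta powi s))"
    unfolding Let_def catalan Fibonacci_def powi[OF nz(1)] powi[OF nz(2)] diff
    by (simp only: diff_divide_distrib times_divide_eq_right divide_divide_eq_left mult_ac)
  have "(\<lambda>k. alpha powi s * (alpha ^ (2 * Suc k) / ?d k) + beta powi s * (beta ^ (2 * Suc k) / ?d k))
      sums (alpha powi s * (9 * pi\<^sup>2 / 50) + beta powi s * (pi\<^sup>2 / 50))"
    by (intro sums_add A B)
  moreover have "alpha powi s * (9 * pi\<^sup>2 / 50) + beta powi s * (pi\<^sup>2 / 50)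
      = pi\<^sup>2 / 50 * (9 * alpha powi s + beta powi s)"
    by (simp add: field_simps)
  ultimately show "(\<lambda>k. let n = Suc k in
            Lucas (2 * int n + s) / ((real n)\<^sup>2 * (real n + 1) * catalan n))
           sums (pi\<^sup>2 / 50 * (9 * alpha powi s + beta powi s))"
    unfolding Let_def catalan Lucas_def powi[OF nz(1)] powi[OF nz(2)]
    by (simp only: add_divide_distrib times_divide_eq_right)
qed

end
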